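(* Let $G=(V,E)$ be a connected, undirected, unweighted multigraph with $m\ge1$ edges which is a $\Phi$-expander, with incidence matrix $\mathbf{B}$, Laplacian $\mathbf{L}=\mathbf{B}\mathbf{B}^\top$ and electrical routing $\mathbf{A}_{\mathcal{E}}=\mathbf{B}^\top\mathbf{L}^+$. Then for every $p\in[1,\infty]$, \[ \rho_p(\mathbf{A}_{\mathcal{E}})\le 3\cdot\frac{\log(2m)}{\Phi}. \]
   Context: Each edge is given an arbitrary orientation; $\mathbf{B}\in\mathbb{R}^{V\times E}$ has $\mathbf{B}(u,e)=-1$ if $e=(u,v)$, $\mathbf{B}(u,e)=1$ if $e=(v,u)$, and $0$ otherwise. $\mathbf{L}^+$ is the pseudo-inverse. $\log$ is the natural logarithm. $G$ is a $\Phi$-expander if $|\partial S|\ge\Phi\cdot\mathrm{vol}(S)$ for all $S\subseteq V$ with $\mathrm{vol}(S)\le\mathrm{vol}(V)/2$, where $|\partial S|$ counts edges (with multiplicity) with exactly one endpoint in $S$ and $\mathrm{vol}(S)$ is the sum of degrees in $S$. A demand is $\boldsymbol{\chi}\in\mathbb{R}^V$ with $\mathbf{1}^\top\boldsymbol{\chi}=0$; a flow $\mathbf{f}\in\mathbb{R}^E$ routes $\boldsymbol{\chi}$ if $\mathbf{B}\mathbf{f}=\boldsymbol{\chi}$. For a linear map $\mathbf{A}\in\mathbb{R}^{E\times V}$ with $\mathbf{B}\mathbf{A}\boldsymbol{\chi}=\boldsymbol{\chi}$ for all demands, $\rho_p(\mathbf{A})=\sup_D \|\sum_i|\mathbf{A}\boldsymbol{\chi}_i|\|_p/\mathrm{opt}_p(D)$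 over multisets $D=\{\boldsymbol{\chi}_1,\dots,\boldsymbol{\chi}_k\}$ of demands with $\mathrm{opt}_p(D)>0$, where $\mathrm{opt}_p(D)=\min\{\|\sum_i|\mathbf{f}_i|\|_p : \mathbf{B}\mathbf{f}_i=\boldsymbol{\chi}_i\ \forall i\}$ and $|\cdot|$ is entrywise. *)

theory Defs
  imports "HOL-Analysis.Analysis" "HOL-Library.Multiset"
begin

text \<open>
  A multigraph with vertex set \<open>UNIV :: 'v set\<close> and edge set \<open>UNIV :: 'e set\<close> is given, together
  with an orientation of its edges, by \<open>t h :: 'e \<Rightarrow> 'v\<close>: the edge \<open>e\<close> is oriented from \<open>t e\<close> to
  \<open>h e\<close>. Parallel edges are distinct elements of \<open>'e\<close>. Self-loops are not excluded: they
  contribute 2 to the degree and a zero column to the incidence matrix.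
\<close>

definition mg_connected :: "('e \<Rightarrow> 'v) \<Rightarrow> ('e \<Rightarrow> 'v) \<Rightarrow> bool" where
  "mg_connected t h \<longleftrightarrow>
     (\<forall>u v. (u, v) \<in> {(a, b). \<exists>e. (t e = a \<and> h e = b) \<or> (t e = b \<and> h e = a)}\<^sup>*)"

definition mg_degree :: "('e::finite \<Rightarrow> 'v) \<Rightarrow> ('e \<Rightarrow> 'v) \<Rightarrow> 'v \<Rightarrow> nat" where
  "mg_degree t h v = card {e. t e = v} + card {e. h e = v}"

definition mg_vol :: "('e::finite \<Rightarrow> 'v::finite) \<Rightarrow> ('e \<Rightarrow> 'v) \<Rightarrow> 'v set \<Rightarrow> nat" where
  "mg_vol t h S = (\<Sum>v\<in>S. mg_degree t h v)"

definition mg_boundary :: "('e \<Rightarrow> 'v) \<Rightarrow> ('e \<Rightarrow> 'v) \<Rightarrow> 'v set \<Rightarrow> 'e set" where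
  "mg_boundary t h S = {e. (t e \<in> S) \<noteq> (h e \<in> S)}"

definition mg_expander :: "real \<Rightarrow> ('e::finite \<Rightarrow> 'v::finite) \<Rightarrow> ('e \<Rightarrow> 'v) \<Rightarrow> bool" where
  "mg_expander \<Phi> t h \<longleftrightarrow>
     (\<forall>S. real (mg_vol t h S) \<le> real (mg_vol t h UNIV) / 2 \<longrightarrow>
          real (card (mg_boundary t h S)) \<ge> \<Phi> * real (mg_vol t h S))"

definition incidence :: "('e::finite \<Rightarrow> 'v::finite) \<Rightarrow> ('e \<Rightarrow> 'v) \<Rightarrow> real^'e^'v" where
  "incidence t h =
     (\<chi> u e. if t e = h e then 0 else if t e = u then -1 else if h e = u then 1 else 0)"

definition laplacian :: "('e::finite \<Rightarrow> 'v::finite) \<Rightarrow> ('e \<Rightarrow> 'v) \<Rightarrow> real^'v^'v" where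
  "laplacian t h = incidence t h ** transpose (incidence t h)"

text \<open>The Moore--Penrose pseudo-inverse, as the unique solution of the Penrose equations.\<close>

definition pseudo_inverse :: "real^'n^'m \<Rightarrow> real^'m^'n" where
  "pseudo_inverse M =
     (THE X. M ** X ** M = M \<and> X ** M ** X = X \<and>
             transpose (M ** X) = M ** X \<and> transpose (X ** M) = X ** M)"

definition electrical_routing :: "('e::finite \<Rightarrow> 'v::finite) \<Rightarrow> ('e \<Rightarrow> 'v) \<Rightarrow> real^'v^'e" where
  "electrical_routing t h = transpose (incidence t h) ** pseudo_inverse (laplacian t h)"

definition p_norm :: "ereal \<Rightarrow> real^'n \<Rightarrow> real" where
  "p_norm p x =
     (if p = \<infinity> then infnorm x
      else (\<Sum>i\<in>UNIV. \<bar>x $ i\<bar> powr real_of_ereal p) powr (1 / real_of_ereal p))"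

definition is_demand :: "real^'v \<Rightarrow> bool" where
  "is_demand d \<longleftrightarrow> (\<Sum>v\<in>UNIV. d $ v) = 0"

text \<open>
  On vectors, \<open>\<bar>_\<bar>\<close> is the entrywise absolute value. A choice of flows \<open>f\<^sub>i\<close> routing the members
  \<open>d\<^sub>i\<close> of the multiset \<open>D\<close> is a multiset \<open>F\<close> of flows whose image under \<open>B\<close> is \<open>D\<close>.
\<close>

definition opt_congestion ::
  "ereal \<Rightarrow> ('e::finite \<Rightarrow> 'v::finite) \<Rightarrow> ('e \<Rightarrow> 'v) \<Rightarrow> (real^'v) multiset \<Rightarrow> real" where
  "opt_congestion p t h D =
     Inf {p_norm p (\<Sum>f\<in>#F. \<bar>f\<bar>) | F. {#incidence t h *v f. f \<in># F#} = D}"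

definition competitive_ratio ::
  "ereal \<Rightarrow> ('e::finite \<Rightarrow> 'v::finite) \<Rightarrow> ('e \<Rightarrow> 'v) \<Rightarrow> real^'v^'e \<Rightarrow> ereal" where
  "competitive_ratio p t h A =
     (SUP D \<in> {D. (\<forall>d\<in>#D. is_demand d) \<and> opt_congestion p t h D > 0}.
        ereal (p_norm p (\<Sum>d\<in>#D. \<bar>A *v d\<bar>) / opt_congestion p t h D))"

end

theory Submission
  imports Defs
begin

text \<open>
  If flows \<open>f\<^sub>i\<close> route the demands, the electrical routing sends \<open>Q f\<^sub>i\<close> with the symmetric matrix
  \<open>Q = B\<^sup>T L\<^sup>+ B\<close>, so by the Schur test \<open>\<rho>\<^sub>p\<close> is at most the largest \<open>\<ell>\<^sub>1\<close> norm of a column of \<open>Q\<close>,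
  i.e. of the electrical flow for the demand of a single edge.

  Let \<open>x\<close> be its potential, \<open>\<delta>\<^sub>e\<close> the potential drop along \<open>e\<close>, and let \<open>c(s)\<close> be the number of
  edges crossing the level cut \<open>S\<^sub>s = {x > s}\<close>. The norm is the integral of \<open>c\<close>. At most one unit
  of flow crosses the cut, so \<open>c(s)\<^sup>2 \<le> \<Sum> 1 / \<delta>\<^sub>e\<close> over the crossing edges by Cauchy--Schwarz. Above
  the volume median \<open>c(s) \<ge> \<Phi> vol S\<^sub>s\<close>, hence \<open>\<Phi> c(s) \<le> \<Sum> 1 / (\<delta>\<^sub>e vol {x \<ge> x\<^sub>u})\<close> with \<open>u\<close> the upper
  endpoint of \<open>e\<close>. Integrating over \<open>s\<close> cancels \<open>\<delta>\<^sub>e\<close> and leaves the harmonic-type sum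
  \<open>\<Sum> deg u / vol {x \<ge> x\<^sub>u} \<le> 1 + ln m\<close>. The part below the median is symmetric, and
  \<open>2 (1 + ln m) \<le> 3 ln (2 m)\<close> because \<open>ln 2 \<ge> 2/3\<close>.
\<close>

subsection \<open>Level cuts of a potential on an expander\<close>

text \<open>Elements are inserted in order of decreasing \<open>x\<close>, so the upper sum of the
  new one is the whole weight and its term \<open>w v / (w v + W)\<close> is at most
  \<open>ln (w v + W) - ln W\<close>. These bounds telescope; the additive 1 pays for the first
  positive weight.\<close>

lemma sum_div_upper_sum_le_ln:
  fixes w :: "'a \<Rightarrow> nat" and x :: "'a \<Rightarrow> real"
  assumes "finite T"
  shows "(\<Sum>v\<in>T. real (w v) / real (\<Sum>u | u \<in> T \<and> x v \<le> x u. w u)) \<le> 1 + ln (real (\<Sum>v\<in>T. w v))"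
  using assms
proof (induction T rule: finite_ranking_induct[where f = "\<lambda>v. - x v"])
  case empty
  then show ?case by simp
next
  case (insert v T)
  show ?case
  proof (cases "v \<in> T")
    case True
    then show ?thesis using insert by (simp add: insert_absorb)
  next
    case False
    define W where "W = (\<Sum>v\<in>T. w v)"
    define g where "g S u = real (\<Sum>z | z \<in> S \<and> x u \<le> x z. w z)" for S u
    have W: "(\<Sum>u\<in>insert v T. w u) = w v + W"
      using insert False by (simp add: W_def)
    have "{z. z \<in> insert v T \<and> x v \<le> x z} = insert v T"
      using insert by auto
    then have gv: "g (insert v T) v = real (w v + W)"
      using W by (simp add: g_def)
    \<comment> \<open>Inserting \<open>v\<close> affects the upper sum of an older \<open>u\<close>
      only in a tie, and then it enlarges the denominator.\<close>
    have mono: "real (w u) / g (insert v T) u \<le> real (w u) / g T u" if "u \<in> T" for u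
    proof (cases "w u = 0")
      case False
      have "w u \<le> (\<Sum>z | z \<in> T \<and> x u \<le> x z. w z)"
        using insert that by (intro member_le_sum) auto
      with False have "0 < g T u" by (simp add: g_def del: of_nat_sum)
      moreover have "g T u \<le> g (insert v T) u"
        unfolding g_def of_nat_le_iff using insert by (intro sum_mono2) auto
      ultimately show ?thesis by (intro divide_left_mono) auto
    qed simp
    have "(\<Sum>u\<in>insert v T. real (w u) / g (insert v T) u)
        = real (w v) / real (w v + W) + (\<Sum>u\<in>T. real (w u) / g (insert v T) u)"
      using insert False gv by simp
    also have "\<dots> \<le> real (w v) / real (w v + W) + (\<Sum>u\<in>T. real (w u) / g T u)"
      using mono by (intro add_mono sum_mono) auto
    also have "\<dots> \<le> 1 + ln (real (w v + W))"
    proof (cases "W = 0")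
      case True
      then have "\<forall>u\<in>T. w u = 0" using insert by (simp add: W_def)
      then have "(\<Sum>u\<in>T. real (w u) / g T u) = 0" by simp
      moreover have "0 \<le> ln (real (w v))" by (cases "w v = 0") auto
      ultimately show ?thesis using True by simp
    next
      case False
      have "ln (real W / real (w v + W)) \<le> real W / real (w v + W) - 1"
        using False by (intro ln_le_minus_one) auto
      moreover have "real W / real (w v + W) - 1 = - (real (w v) / real (w v + W))"
        using False by (simp add: field_simps)
      ultimately have "real (w v) / real (w v + W) \<le> ln (real (w v + W)) - ln (real W)"
        using False by (simp add: ln_div)
      moreover have "(\<Sum>u\<in>T. real (w u) / g T u) \<le> 1 + ln (real W)"
        using insert by (simp add: g_def W_def)
      ultimately show ?thesis by simp
    qed
    finally show ?thesis unfolding W g_def by simp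
  qed
qed

text \<open>Integration over \<open>s\<close> turns an inequality valid at each level into one
  between weighted interval lengths; \<open>max 0\<close> accounts for empty intervals.\<close>

lemma sum_interval_lengths_nonneg:
  fixes c a b :: "'i \<Rightarrow> real"
  assumes "finite I" "\<And>s. 0 \<le> (\<Sum>i\<in>I. c i * indicator {a i..<b i} s)"
  shows "0 \<le> (\<Sum>i\<in>I. c i * max 0 (b i - a i))"
proof -
  have int: "integrable lborel (\<lambda>s. c i * indicator {a i..<b i} s)" for i
    by (cases "a i \<le> b i") auto
  have "0 \<le> (LINT s|lborel. (\<Sum>i\<in>I. c i * indicator {a i..<b i} s))"
    using assms by (intro integral_nonneg_AE) auto
  also have "\<dots> = (\<Sum>i\<in>I. LINT s|lborel. c i * indicator {a i..<b i} s)"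
    by (intro Bochner_Integration.integral_sum int)
  also have "\<dots> = (\<Sum>i\<in>I. c i * max 0 (b i - a i))"
    by (intro sum.cong refl) (auto simp: measure_def max_def)
  finally show ?thesis .
qed

text \<open>Cauchy--Schwarz for \<open>sqrt (d i)\<close> and \<open>sqrt (1 / d i)\<close>, whose
  products are all 1.\<close>

lemma card_squared_le_sum_inverse:
  fixes d :: "'i \<Rightarrow> real"
  assumes "\<And>i. i \<in> I \<Longrightarrow> 0 < d i" "(\<Sum>i\<in>I. d i) \<le> 1"
  shows "(real (card I))\<^sup>2 \<le> (\<Sum>i\<in>I. 1 / d i)"
proof -
  have "(\<Sum>i\<in>I. sqrt (d i) * sqrt (1 / d i))\<^sup>2 \<le> (\<Sum>i\<in>I. (sqrt (d i))\<^sup>2) * (\<Sum>i\<in>I. (sqrt (1 / d i))\<^sup>2)"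
    by (rule Cauchy_Schwarz_ineq_sum)
  also have "(\<Sum>i\<in>I. sqrt (d i) * sqrt (1 / d i)) = (\<Sum>i\<in>I. 1)"
    using assms(1) by (intro sum.cong refl) (auto simp: real_sqrt_divide dest!: assms(1))
  also have "(\<Sum>i\<in>I. (sqrt (d i))\<^sup>2) = (\<Sum>i\<in>I. d i)"
    using assms(1) by (intro sum.cong refl) (simp add: less_imp_le)
  also have "(\<Sum>i\<in>I. (sqrt (1 / d i))\<^sup>2) = (\<Sum>i\<in>I. 1 / d i)"
    using assms(1) by (intro sum.cong refl) (simp add: less_imp_le)
  also have "(\<Sum>i\<in>I. d i) * (\<Sum>i\<in>I. 1 / d i) \<le> 1 * (\<Sum>i\<in>I. 1 / d i)"
    using assms by (intro mult_right_mono sum_nonneg) (auto simp: less_imp_le)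
  finally show ?thesis by simp
qed

section \<open>Degrees, volumes and the volume median of a potential\<close>

lemma sum_card_fibres:
  fixes f :: "'e::finite \<Rightarrow> 'v::finite"
  shows "(\<Sum>v\<in>UNIV. card {e. f e = v}) = CARD('e)"
  using sum.group[of "UNIV :: 'e set" "UNIV :: 'v set" f "\<lambda>_. 1 :: nat"] by simp

lemma mg_vol_UNIV: "mg_vol t h UNIV = 2 * CARD('e)"
  for t h :: "'e::finite \<Rightarrow> 'v::finite"
  by (simp add: mg_vol_def mg_degree_def sum.distrib sum_card_fibres)

lemma mg_vol_mono: "S \<subseteq> T \<Longrightarrow> mg_vol t h S \<le> mg_vol t h T"
  unfolding mg_vol_def by (rule sum_mono2) auto

lemma mg_vol_compl: "mg_vol t h S + mg_vol t h (- S) = mg_vol t h UNIV"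
  unfolding mg_vol_def by (subst sum.union_disjoint[symmetric]) auto

lemma mg_degree_endpoint_pos:
  assumes "v = t e \<or> v = h e"
  shows "0 < mg_degree t h v"
  using assms by (auto simp: mg_degree_def card_gt_0_iff)

lemma card_chosen_endpoint_le_mg_degree:
  fixes t h :: "'e::finite \<Rightarrow> 'v"
  assumes "\<And>e. u e = t e \<or> u e = h e"
  shows "card {e. u e = v} \<le> mg_degree t h v"
proof -
  have "card {e. u e = v} \<le> card ({e. t e = v} \<union> {e. h e = v})"
    using assms by (intro card_mono) (auto, metis)
  also have "\<dots> \<le> mg_degree t h v"
    unfolding mg_degree_def by (rule card_Un_le)
  finally show ?thesis .
qed

text \<open>The set \<open>A\<close> of vertices with at most half the volume strictly above them
  contains every maximizer of \<open>x\<close>. The threshold is the least value on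
  \<open>A\<close>: the next smaller value, at \<open>z\<close>, lies outside \<open>A\<close>, so
  the vertices at or below it, which are those below \<open>x w\<close>, have less than half the
  volume.\<close>

lemma volume_median_exists:
  fixes x :: "'v::finite \<Rightarrow> real" and t h :: "'e::finite \<Rightarrow> 'v"
  obtains s where "mg_vol t h {v. s < x v} \<le> CARD('e)" "mg_vol t h {v. x v < s} \<le> CARD('e)"
proof -
  define A where "A = {v. mg_vol t h {u. x v < x u} \<le> CARD('e)}"
  have "\<exists>v. \<forall>u. x u \<le> x v"
    using ex_is_arg_min_if_finite[of "UNIV :: 'v set" "\<lambda>v. - x v"] by (auto simp: is_arg_min_linorder)
  then obtain v where "\<forall>u. x u \<le> x v" by blast
  then have "{u. x v < x u} = {}" by (auto simp: not_less)
  then have "v \<in> A" by (simp add: A_def mg_vol_def)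
  then obtain w where w: "w \<in> A" "\<And>u. u \<in> A \<Longrightarrow> x w \<le> x u"
    using ex_is_arg_min_if_finite[of A x] by (auto simp: is_arg_min_linorder)
  have "mg_vol t h {u. x u < x w} \<le> CARD('e)"
  proof (cases "{u. x u < x w} = {}")
    case True
    then show ?thesis by (simp add: mg_vol_def)
  next
    case False
    then obtain z where z: "x z < x w" "\<And>u. x u < x w \<Longrightarrow> x u \<le> x z"
      using ex_is_arg_min_if_finite[of "{u. x u < x w}" "\<lambda>v. - x v"] by (auto simp: is_arg_min_linorder)
    have "z \<notin> A" using w(2) z(1) by force
    then have "CARD('e) < mg_vol t h {u. x z < x u}" by (simp add: A_def)
    moreover have "- {u. x z < x u} = {u. x u < x w}"
      using z by (force simp: not_less)
    ultimately show ?thesis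
      using mg_vol_compl[of t h "{u. x z < x u}"] by (simp add: mg_vol_UNIV)
  qed
  with w(1) show thesis using that by (simp add: A_def)
qed

text \<open>Only the part of each edge's potential interval above \<open>s0\<close> is summed.
  Hypothesis \<open>cut\<close> is the bound of one unit on the flow through a level cut, the flow
  on an edge being its potential drop.\<close>

lemma sum_potential_drop_above_le:
  fixes x :: "'v::finite \<Rightarrow> real" and t h :: "'e::finite \<Rightarrow> 'v"
  assumes "\<Phi> > 0" "mg_expander \<Phi> t h"
    and vol: "mg_vol t h {v. s0 < x v} \<le> CARD('e)"
    and cut: "\<And>s. (\<Sum>e\<in>mg_boundary t h {v. s < x v}. \<bar>x (h e) - x (t e)\<bar>) \<le> 1"
  shows "(\<Sum>e\<in>UNIV. max 0 (max (x (t e)) (x (h e)) - max s0 (min (x (t e)) (x (h e)))))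
           \<le> (1 + ln (real CARD('e))) / \<Phi>"
proof -
  define u where "u e = (if x (t e) \<le> x (h e) then h e else t e)" for e
  define l where "l e = min (x (t e)) (x (h e))" for e
  define d where "d e = x (u e) - l e" for e
  define len where "len e = max 0 (x (u e) - max s0 (l e))" for e
  \<comment> \<open>\<open>W (u e)\<close> is a lower bound, independent of the level, for the
    volume of every upper level set whose cut \<open>e\<close> crosses.\<close>
  define W where "W v = real (mg_vol t h {z. x v \<le> x z})" for v
  have r: "max (x (t e)) (x (h e)) = x (u e)" for e by (auto simp: u_def)
  have d: "\<bar>x (h e) - x (t e)\<bar> = d e" for e by (auto simp: d_def u_def l_def)
  have bd: "mg_boundary t h {v. s < x v} = {e. l e \<le> s \<and> s < x (u e)}" for s
    by (auto simp: mg_boundary_def l_def u_def)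
  have Wpos: "0 < W (u e)" for e
  proof -
    have "mg_degree t h (u e) \<le> mg_vol t h {z. x (u e) \<le> x z}"
      unfolding mg_vol_def by (intro member_le_sum) auto
    moreover have "0 < mg_degree t h (u e)"
      by (rule mg_degree_endpoint_pos[of _ _ e]) (simp add: u_def)
    ultimately show ?thesis by (simp add: W_def)
  qed
  \<comment> \<open>Expansion gives \<open>\<Phi> * V \<le> card C\<close>, and Cauchy--Schwarz
    bounds the square of \<open>card C\<close>. Replacing \<open>V\<close> by \<open>W (u e)\<close>
    leaves only the set of crossing edges dependent on \<open>s\<close>, so the result can be
    integrated.\<close>
  have level: "\<Phi> * real (card {e. l e \<le> s \<and> s < x (u e)})
                 \<le> (\<Sum>e | l e \<le> s \<and> s < x (u e). 1 / (d e * W (u e)))" if "s0 \<le> s" for s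
  proof (cases "{e. l e \<le> s \<and> s < x (u e)} = {}")
    case False
    define C where "C = {e. l e \<le> s \<and> s < x (u e)}"
    define V where "V = real (mg_vol t h {v. s < x v})"
    have dpos: "0 < d e" if "e \<in> C" for e using that by (simp add: C_def d_def)
    have WV: "W (u e) \<le> V" if "e \<in> C" for e
      unfolding W_def V_def using that by (auto simp: C_def intro!: mg_vol_mono)
    have Vpos: "0 < V" using False Wpos WV unfolding C_def[symmetric]
      by (metis all_not_in_conv less_le_trans)
    have "mg_vol t h {v. s < x v} \<le> CARD('e)"
      using vol mg_vol_mono[of "{v. s < x v}" "{v. s0 < x v}" t h] that by fastforce
    then have "\<Phi> * V \<le> real (card C)"
      using assms(2) by (auto simp: mg_expander_def V_def C_def mg_vol_UNIV bd[symmetric])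
    then have "\<Phi> * V * real (card C) \<le> real (card C) * real (card C)"
      by (rule mult_right_mono) simp
    then have "\<Phi> * real (card C) \<le> (real (card C))\<^sup>2 / V"
      using Vpos by (simp add: field_simps power2_eq_square)
    also have "(real (card C))\<^sup>2 \<le> (\<Sum>e\<in>C. 1 / d e)"
      using cut[of s] dpos by (intro card_squared_le_sum_inverse) (auto simp: d bd C_def)
    then have "(real (card C))\<^sup>2 / V \<le> (\<Sum>e\<in>C. 1 / d e) / V"
      using Vpos by (intro divide_right_mono) auto
    also have "\<dots> = (\<Sum>e\<in>C. 1 / (d e * V))"
      by (simp add: sum_divide_distrib)
    also have "\<dots> \<le> (\<Sum>e\<in>C. 1 / (d e * W (u e)))"
      using dpos WV Wpos Vpos by (intro sum_mono divide_left_mono mult_left_mono)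
        (auto simp: less_imp_le)
    finally show ?thesis by (simp add: C_def)
  next
    case True
    show ?thesis unfolding True by simp
  qed
  \<comment> \<open>The half-open intervals match the crossing condition, and starting them at
    \<open>max s0 (l e)\<close> makes the integrand vanish below \<open>s0\<close>, where
    \<open>level\<close> gives nothing.\<close>
  have "0 \<le> (\<Sum>e\<in>UNIV. (1 / (d e * W (u e)) - \<Phi>) * max 0 (x (u e) - max s0 (l e)))"
  proof (rule sum_interval_lengths_nonneg)
    fix s
    show "0 \<le> (\<Sum>e\<in>UNIV. (1 / (d e * W (u e)) - \<Phi>) * indicator {max s0 (l e)..<x (u e)} s)"
    proof (cases "s0 \<le> s")
      case True
      then have "(\<Sum>e\<in>UNIV. (1 / (d e * W (u e)) - \<Phi>) * indicator {max s0 (l e)..<x (u e)} s)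
               = (\<Sum>e | l e \<le> s \<and> s < x (u e). 1 / (d e * W (u e)) - \<Phi>)"
        by (intro sum.mono_neutral_cong_right) (auto simp: indicator_def)
      then show ?thesis using level[OF True] by (simp add: sum_subtractf mult.commute)
    qed simp
  qed simp
  then have "\<Phi> * (\<Sum>e\<in>UNIV. len e) \<le> (\<Sum>e\<in>UNIV. 1 / (d e * W (u e)) * len e)"
    by (simp add: len_def left_diff_distrib sum_subtractf sum_distrib_left)
  \<comment> \<open>The drop cancels because \<open>len e \<le> d e\<close>; edges with zero drop or
    with upper endpoint not above \<open>s0\<close> contribute 0 on the left.\<close>
  also have "\<dots> \<le> (\<Sum>e\<in>UNIV. if s0 < x (u e) then 1 / W (u e) else 0)"
  proof (intro sum_mono)
    fix e
    show "1 / (d e * W (u e)) * len e \<le> (if s0 < x (u e) then 1 / W (u e) else 0)"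
    proof (cases "s0 < x (u e) \<and> d e \<noteq> 0")
      case True
      moreover have "0 \<le> d e" using d[of e] by (metis abs_ge_zero)
      moreover have "len e \<le> d e" using \<open>0 \<le> d e\<close> by (auto simp: len_def d_def)
      ultimately show ?thesis using Wpos[of e] by (simp add: field_simps)
    next
      case False
      then show ?thesis using Wpos[of e] by (auto simp: len_def)
    qed
  qed
  also have "\<dots> = (\<Sum>e | s0 < x (u e). 1 / W (u e))"
    by (simp add: sum.If_cases)
  \<comment> \<open>Grouping by upper endpoint turns the sum over edges into one over vertices, with
    multiplicities bounded by degrees.\<close>
  also have "\<dots> = (\<Sum>v | s0 < x v. \<Sum>e | e \<in> {e. s0 < x (u e)} \<and> u e = v. 1 / W (u e))"
    by (rule sum.group[symmetric]) auto
  also have "\<dots> = (\<Sum>v | s0 < x v. real (card {e. u e = v}) / W v)"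
  proof (intro sum.cong refl)
    fix v assume "v \<in> {v. s0 < x v}"
    then have "{e. e \<in> {e. s0 < x (u e)} \<and> u e = v} = {e. u e = v}" by auto
    then show "(\<Sum>e | e \<in> {e. s0 < x (u e)} \<and> u e = v. 1 / W (u e)) = real (card {e. u e = v}) / W v"
      by simp
  qed
  also have "\<dots> \<le> (\<Sum>v | s0 < x v. real (mg_degree t h v) / W v)"
    using card_chosen_endpoint_le_mg_degree[of u t h]
    by (intro sum_mono divide_right_mono) (auto simp: u_def W_def)
  also have "\<dots> = (\<Sum>v | s0 < x v. real (mg_degree t h v) /
                     real (\<Sum>z | z \<in> {v. s0 < x v} \<and> x v \<le> x z. mg_degree t h z))"
    unfolding W_def mg_vol_def
    by (intro sum.cong refl arg_cong2[where f = "(/)"] arg_cong[where f = real]) auto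
  also have "\<dots> \<le> 1 + ln (real (mg_vol t h {v. s0 < x v}))"
    unfolding mg_vol_def by (rule sum_div_upper_sum_le_ln) simp
  also have "\<dots> \<le> 1 + ln (real CARD('e))"
    using vol by (cases "mg_vol t h {v. s0 < x v} = 0") auto
  finally show ?thesis
    unfolding r l_def[symmetric] len_def[symmetric]
    using assms(1) by (simp add: field_simps)
qed

text \<open>The one-sided bound is applied at a median to \<open>x\<close> and to
  \<open>- x\<close>.\<close>

lemma sum_potential_drop_le:
  fixes x :: "'v::finite \<Rightarrow> real" and t h :: "'e::finite \<Rightarrow> 'v"
  assumes "\<Phi> > 0" "mg_expander \<Phi> t h"
    and up: "\<And>s. (\<Sum>e\<in>mg_boundary t h {v. s < x v}. \<bar>x (h e) - x (t e)\<bar>) \<le> 1"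
    and down: "\<And>s. (\<Sum>e\<in>mg_boundary t h {v. x v < s}. \<bar>x (h e) - x (t e)\<bar>) \<le> 1"
  shows "(\<Sum>e\<in>UNIV. \<bar>x (h e) - x (t e)\<bar>) \<le> 2 * (1 + ln (real CARD('e))) / \<Phi>"
proof -
  obtain s where s: "mg_vol t h {v. s < x v} \<le> CARD('e)" "mg_vol t h {v. x v < s} \<le> CARD('e)"
    by (rule volume_median_exists)
  note A = sum_potential_drop_above_le[OF assms(1,2) s(1) up]
  have "(\<Sum>e\<in>mg_boundary t h {v. z < - x v}. \<bar>- x (h e) - - x (t e)\<bar>) \<le> 1" for z
    using down[of "-z"] by (simp add: less_minus_iff[of z] abs_minus_commute minus_diff_commute add.commute)
  then have B: "(\<Sum>e\<in>UNIV. max 0 (max (- x (t e)) (- x (h e)) - max (- s) (min (- x (t e)) (- x (h e)))))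
                  \<le> (1 + ln (real CARD('e))) / \<Phi>"
    using s(2) by (intro sum_potential_drop_above_le[OF assms(1,2)]) auto
  \<comment> \<open>Each potential interval is cut at \<open>s\<close>; the reflected sum measures
    the part below.\<close>
  have "(\<Sum>e\<in>UNIV. \<bar>x (h e) - x (t e)\<bar>)
      = (\<Sum>e\<in>UNIV. max 0 (max (x (t e)) (x (h e)) - max s (min (x (t e)) (x (h e)))))
        + (\<Sum>e\<in>UNIV. max 0 (max (- x (t e)) (- x (h e)) - max (- s) (min (- x (t e)) (- x (h e)))))"
    unfolding sum.distrib[symmetric]
    by (intro sum.cong refl) (auto simp: max_def min_def abs_if)
  also have "\<dots> \<le> 2 * (1 + ln (real CARD('e))) / \<Phi>"
    using add_mono[OF A B] by (simp add: field_simps)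
  finally show ?thesis .
qed

subsection \<open>The pseudo-inverse of the Laplacian\<close>

text \<open>Uniqueness of the Penrose solution: symmetry forces \<open>M ** X = M ** Y\<close> and
  \<open>X ** M = Y ** M\<close>, whence \<open>Y = Y ** M ** Y = X ** M ** X = X\<close>.\<close>

lemma pseudo_inverse_eqI:
  fixes M :: "real^'n^'m" and X :: "real^'m^'n"
  assumes X: "M ** X ** M = M" "X ** M ** X = X" "transpose (M ** X) = M ** X" "transpose (X ** M) = X ** M"
  shows "pseudo_inverse M = X"
  unfolding pseudo_inverse_def
proof (rule the_equality)
  fix Y
  assume Y: "M ** Y ** M = M \<and> Y ** M ** Y = Y \<and> transpose (M ** Y) = M ** Y \<and> transpose (Y ** M) = Y ** M"
  have "M ** X = transpose (M ** Y ** (M ** X))"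
    using X(3) Y by (simp add: matrix_mul_assoc)
  also have "\<dots> = M ** X ** (M ** Y)"
    using X(3) Y by (simp add: matrix_transpose_mul)
  also have "\<dots> = M ** Y"
    using X(1) by (simp add: matrix_mul_assoc)
  finally have MX: "M ** X = M ** Y" .
  have "X ** M = transpose (X ** M ** (Y ** M))"
    using X(4) Y by (metis matrix_mul_assoc)
  also have "\<dots> = Y ** M ** (X ** M)"
    using X(4) Y by (simp add: matrix_transpose_mul)
  also have "\<dots> = Y ** M"
    using X(1) by (metis matrix_mul_assoc)
  finally have XM: "X ** M = Y ** M" .
  have "Y = Y ** M ** Y" using Y by simp
  also have "\<dots> = X ** (M ** Y)" by (simp add: XM matrix_mul_assoc)
  also have "\<dots> = X" unfolding MX[symmetric] using X(2) by (simp add: matrix_mul_assoc)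
  finally show "Y = X" .
qed (use X in blast)

section \<open>Incidence matrix, cuts and the kernel of the Laplacian\<close>

lemma transpose_incidence_mult:
  "(transpose (incidence t h) *v x) $ e = x $ h e - x $ t e"
proof -
  have "(transpose (incidence t h) *v x) $ e
      = (\<Sum>v\<in>UNIV. (if v = h e then x $ v else 0) - (if v = t e then x $ v else 0))"
    unfolding matrix_vector_mult_def transpose_def incidence_def
    by (auto intro!: sum.cong)
  then show ?thesis by (simp add: sum_subtractf)
qed

lemma inner_incidence:
  "x \<bullet> (incidence t h *v f) = (transpose (incidence t h) *v x) \<bullet> f"
  by (simp add: dot_lmul_matrix[symmetric])

text \<open>Pairing \<open>B f\<close> with the indicator vector of \<open>S\<close> leaves only the
  edges leaving or entering \<open>S\<close>. For \<open>S = UNIV\<close> it shows that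
  \<open>B f\<close> is a demand.\<close>

lemma net_flow_across_cut:
  "(\<Sum>v\<in>S. (incidence t h *v f) $ v) = (\<Sum>e\<in>UNIV. (of_bool (h e \<in> S) - of_bool (t e \<in> S)) * f $ e)"
proof -
  have "(\<Sum>v\<in>S. (incidence t h *v f) $ v) = (\<chi> v. of_bool (v \<in> S)) \<bullet> (incidence t h *v f)"
    unfolding inner_vec_def by (intro sum.mono_neutral_cong_left) auto
  also have "\<dots> = (\<Sum>e\<in>UNIV. (of_bool (h e \<in> S) - of_bool (t e \<in> S)) * f $ e)"
    unfolding inner_incidence unfolding inner_vec_def transpose_incidence_mult by simp
  finally show ?thesis .
qed

lemma mg_connected_constant:
  assumes "mg_connected t h" "\<And>e. x (t e) = x (h e)"
  shows "x u = x v"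
proof -
  have "(u, v) \<in> {(a, b). \<exists>e. (t e = a \<and> h e = b) \<or> (t e = b \<and> h e = a)}\<^sup>*"
    using assms(1) by (simp add: mg_connected_def)
  then show ?thesis
    by (induction rule: rtrancl_induct) (use assms(2) in force)+
qed

text \<open>The orthogonal projection onto the constant vectors, the kernel of the Laplacian of a
  connected graph.\<close>

definition avg_matrix :: "real^'v^'v" where
  "avg_matrix = (\<chi> i j. 1 / real CARD('v))"

lemma avg_matrix_mult: "(avg_matrix *v x) $ i = (\<Sum>j\<in>UNIV. x $ j) / real CARD('v)"
  for x :: "real^'v"
  by (simp add: avg_matrix_def matrix_vector_mult_def sum_divide_distrib)

lemma transpose_avg_matrix: "transpose avg_matrix = avg_matrix"
  by (simp add: avg_matrix_def transpose_def)

lemma avg_matrix_idem: "avg_matrix ** avg_matrix = avg_matrix"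
  by (simp add: avg_matrix_def matrix_matrix_mult_def vec_eq_iff)

lemma avg_matrix_incidence: "avg_matrix ** incidence t h = 0"
proof -
  have "(avg_matrix ** incidence t h) *v f = 0 *v f" for f
    using net_flow_across_cut[of t h f UNIV]
    by (simp add: matrix_vector_mul_assoc[symmetric] vec_eq_iff avg_matrix_mult)
  then show ?thesis by (simp add: matrix_eq)
qed

lemma transpose_laplacian: "transpose (laplacian t h) = laplacian t h"
  by (simp add: laplacian_def matrix_transpose_mul)

lemma avg_matrix_laplacian: "avg_matrix ** laplacian t h = 0"
  by (simp add: laplacian_def matrix_mul_assoc avg_matrix_incidence)

lemma transpose_plus: "transpose (A + B) = transpose A + transpose B"
  for A B :: "real^'n^'m"
  by (simp add: transpose_def vec_eq_iff)

lemma transpose_minus: "transpose (A - B) = transpose A - transpose B"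
  for A B :: "real^'n^'m"
  by (simp add: transpose_def vec_eq_iff)

lemma matrix_sub_ldistrib: "A ** (B - C) = A ** B - A ** C"
  for A :: "real^'n^'m"
  by (simp add: matrix_matrix_mult_def vec_eq_iff right_diff_distrib sum_subtractf)

lemma matrix_sub_rdistrib: "(A - B) ** C = A ** C - B ** C"
  for A :: "real^'n^'m"
  by (simp add: matrix_matrix_mult_def vec_eq_iff left_diff_distrib sum_subtractf)

lemma matrix_add_rdistrib: "(A + B) ** C = A ** C + B ** C"
  for A :: "real^'n^'m"
  by (simp add: matrix_matrix_mult_def vec_eq_iff distrib_right sum.distrib)

lemma laplacian_avg_matrix: "laplacian t h ** avg_matrix = 0"
  using arg_cong[OF avg_matrix_laplacian[of t h], of transpose]
  by (simp add: matrix_transpose_mul transpose_laplacian transpose_avg_matrix)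
    (simp add: transpose_def vec_eq_iff)

text \<open>The quadratic form of the Laplacian at \<open>x\<close> is the squared norm of the
  vector of potential differences.\<close>

lemma laplacian_kernel:
  assumes "laplacian t h *v x = 0"
  shows "x $ t e = x $ h e"
proof -
  have "(transpose (incidence t h) *v x) \<bullet> (transpose (incidence t h) *v x) = x \<bullet> (laplacian t h *v x)"
    by (simp add: laplacian_def matrix_vector_mul_assoc[symmetric] inner_incidence)
  then have "transpose (incidence t h) *v x = 0" using assms by simp
  then show ?thesis using transpose_incidence_mult[of t h x e] by simp
qed

text \<open>For a connected graph, the pseudo-inverse is \<open>(L + J/n)\<^sup>-\<^sup>1 - J/n\<close> with \<open>J\<close> the all-ones matrix.\<close>

lemma pseudo_inverse_laplacian:
  fixes t h :: "'e::finite \<Rightarrow> 'v::finite"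
  assumes "mg_connected t h"
  shows "laplacian t h ** pseudo_inverse (laplacian t h) = mat 1 - avg_matrix"
    and "transpose (pseudo_inverse (laplacian t h)) = pseudo_inverse (laplacian t h)"
proof -
  let ?L = "laplacian t h" and ?P = "avg_matrix"
  \<comment> \<open>Applying \<open>?P\<close> isolates \<open>?P *v x = 0\<close>, so
    \<open>?L *v x = 0\<close> as well; then \<open>x\<close> is constant by connectivity and has
    mean zero.\<close>
  have ker: "x = 0" if "(?L + ?P) *v x = 0" for x
  proof -
    have "?P *v ((?L + ?P) *v x) = 0" using that by simp
    then have P0: "?P *v x = 0"
      by (simp add: matrix_vector_mul_assoc matrix_add_ldistrib avg_matrix_laplacian avg_matrix_idem)
    then have "?L *v x = 0" using that by (simp add: matrix_vector_mult_add_rdistrib)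
    then have "x $ u = x $ v" for u v
      using mg_connected_constant[OF assms, of "\<lambda>v. x $ v"] laplacian_kernel by blast
    then have "(\<Sum>j\<in>UNIV. x $ j) = (\<Sum>j\<in>(UNIV :: 'v set). x $ v)" for v
      by (intro sum.cong refl)
    then show "x = 0" using P0 by (simp add: vec_eq_iff avg_matrix_mult)
  qed
  then obtain N where NM: "N ** (?L + ?P) = mat 1"
    using matrix_left_invertible_ker[of "?L + ?P"] by blast
  then have MN: "(?L + ?P) ** N = mat 1" by (simp add: matrix_left_right_inverse)
  have tN: "transpose N = N"
  proof -
    have "transpose N ** (?L + ?P) = mat 1"
      using arg_cong[OF MN, of transpose]
      by (simp add: matrix_transpose_mul transpose_plus transpose_laplacian transpose_avg_matrix transpose_mat)
    then show ?thesis using MN by (metis matrix_mul_assoc matrix_mul_lid matrix_mul_rid)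
  qed
  have "N ** (?L + ?P) ** ?P = ?P" by (simp add: NM)
  then have NP: "N ** ?P = ?P"
    by (simp add: matrix_mul_assoc[symmetric] matrix_add_rdistrib laplacian_avg_matrix avg_matrix_idem)
  have PN: "?P ** N = ?P"
    using arg_cong[OF NP, of transpose] by (simp add: matrix_transpose_mul tN transpose_avg_matrix)
  have LN: "?L ** N = mat 1 - ?P" using MN by (simp add: matrix_add_rdistrib PN eq_diff_eq)
  have NL: "N ** ?L = mat 1 - ?P" using NM by (simp add: matrix_add_ldistrib NP eq_diff_eq)
  \<comment> \<open>Subtracting \<open>?P\<close> makes both products with \<open>?L\<close> equal
    to the symmetric matrix \<open>mat 1 - ?P\<close>, from which the Penrose equations
    follow.\<close>
  define X where "X = N - ?P"
  have LX: "?L ** X = mat 1 - ?P" by (simp add: X_def matrix_sub_ldistrib LN laplacian_avg_matrix)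
  have XL: "X ** ?L = mat 1 - ?P" by (simp add: X_def matrix_sub_rdistrib NL avg_matrix_laplacian)
  have tP: "transpose (mat 1 - ?P) = mat 1 - ?P"
    by (simp add: transpose_minus transpose_mat transpose_avg_matrix)
  have "pseudo_inverse ?L = X"
  proof (rule pseudo_inverse_eqI)
    show "?L ** X ** ?L = ?L" by (simp add: LX matrix_sub_rdistrib avg_matrix_laplacian)
    show "X ** ?L ** X = X"
      by (simp add: XL matrix_sub_rdistrib) (simp add: X_def matrix_sub_ldistrib PN avg_matrix_idem)
  qed (simp_all add: LX XL tP)
  then show "?L ** pseudo_inverse ?L = mat 1 - ?P" "transpose (pseudo_inverse ?L) = pseudo_inverse ?L"
    using LX by (simp_all add: X_def transpose_minus tN transpose_avg_matrix)
qed

subsection \<open>The Schur test\<close>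

text \<open>Jensen's inequality for the \<open>q\<close>-th power with weights
  \<open>a i / R\<close>, where \<open>R\<close> is the total weight on the support;
  \<open>q \<ge> 1\<close> allows \<open>R\<close> to be raised to \<open>K\<close>.\<close>

lemma powr_weighted_sum_le:
  fixes a g :: "'i \<Rightarrow> real"
  assumes "finite I" "1 \<le> q" "\<And>i. i \<in> I \<Longrightarrow> 0 \<le> a i" "\<And>i. i \<in> I \<Longrightarrow> 0 \<le> g i" "(\<Sum>i\<in>I. a i) \<le> K"
  shows "(\<Sum>i\<in>I. a i * g i) powr q \<le> K powr (q - 1) * (\<Sum>i\<in>I. a i * g i powr q)"
proof -
  \<comment> \<open>The dropped terms vanish in both sums. On \<open>S\<close> all points and
    weights are positive, so the weights can be normalised.\<close>
  define S where "S = {i \<in> I. 0 < a i \<and> 0 < g i}"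
  have S: "finite S" "S \<subseteq> I" using assms by (auto simp: S_def)
  have 1: "(\<Sum>i\<in>I. a i * g i) = (\<Sum>i\<in>S. a i * g i)"
    using assms by (intro sum.mono_neutral_right) (auto simp: S_def less_le)
  have 2: "(\<Sum>i\<in>I. a i * g i powr q) = (\<Sum>i\<in>S. a i * g i powr q)"
    using assms by (intro sum.mono_neutral_right) (auto simp: S_def less_le)
  show ?thesis
  proof (cases "S = {}")
    case True
    then show ?thesis unfolding 1 2 by simp
  next
    case False
    define R where "R = (\<Sum>i\<in>S. a i)"
    have R: "0 < R" unfolding R_def using S False by (intro sum_pos) (auto simp: S_def)
    have "R \<le> (\<Sum>i\<in>I. a i)" unfolding R_def using assms S by (intro sum_mono2) auto
    then have RK: "R \<le> K" using assms by simp
    have "(\<Sum>i\<in>S. (a i / R) *\<^sub>R g i) powr q \<le> (\<Sum>i\<in>S. (a i / R) * g i powr q)"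
      using R assms(2) S False
      by (intro convex_on_sum[OF _ _ powr_convex]) (auto simp: S_def R_def sum_divide_distrib[symmetric])
    moreover have "(\<Sum>i\<in>S. (a i / R) *\<^sub>R g i) = (\<Sum>i\<in>S. a i * g i) / R"
      by (simp add: sum_divide_distrib)
    moreover have "(\<Sum>i\<in>S. (a i / R) * g i powr q) = (\<Sum>i\<in>S. a i * g i powr q) / R"
      by (simp add: sum_divide_distrib)
    moreover have "0 \<le> (\<Sum>i\<in>S. a i * g i)" by (intro sum_nonneg) (auto simp: S_def)
    ultimately have "(\<Sum>i\<in>S. a i * g i) powr q / R powr q \<le> (\<Sum>i\<in>S. a i * g i powr q) / R"
      using R by (simp add: powr_divide)
    then have "(\<Sum>i\<in>S. a i * g i) powr q \<le> R powr q / R * (\<Sum>i\<in>S. a i * g i powr q)"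
      using R by (simp add: field_simps)
    also have "R powr q / R = R powr (q - 1)" using R by (simp add: powr_diff)
    also have "R powr (q - 1) * (\<Sum>i\<in>S. a i * g i powr q) \<le> K powr (q - 1) * (\<Sum>i\<in>S. a i * g i powr q)"
      using R RK assms(2) by (intro mult_right_mono powr_mono2 sum_nonneg) (auto simp: S_def)
    finally show ?thesis unfolding 1 2 .
  qed
qed

text \<open>For finite \<open>p\<close>, Jensen in each row costs \<open>K powr (q - 1)\<close> and
  the column sums supply the remaining factor \<open>K\<close>; for infinite \<open>p\<close> the
  row sums suffice. Entrywise domination of \<open>y\<close> admits sums of absolute values of
  several images.\<close>

lemma p_norm_schur_test:
  fixes A :: "real^'n^'m" and g :: "real^'n" and y :: "real^'m"
  assumes "1 \<le> p"
    and row: "\<And>i. (\<Sum>j\<in>UNIV. \<bar>A $ i $ j\<bar>) \<le> K"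
    and col: "\<And>j. (\<Sum>i\<in>UNIV. \<bar>A $ i $ j\<bar>) \<le> K"
    and g: "\<And>j. 0 \<le> g $ j"
    and y: "\<And>i. \<bar>y $ i\<bar> \<le> (\<Sum>j\<in>UNIV. \<bar>A $ i $ j\<bar> * g $ j)"
  shows "p_norm p y \<le> K * p_norm p g"
proof -
  have K: "0 \<le> K" by (rule order_trans[OF sum_nonneg row]) simp
  show ?thesis
  proof (cases "p = \<infinity>")
    case True
    have "\<bar>y $ i\<bar> \<le> K * infnorm g" for i
    proof -
      have "(\<Sum>j\<in>UNIV. \<bar>A $ i $ j\<bar> * g $ j) \<le> (\<Sum>j\<in>UNIV. \<bar>A $ i $ j\<bar> * infnorm g)"
        using component_le_infnorm_cart[of g] g
        by (intro sum_mono mult_left_mono) (auto intro: order_trans[OF abs_ge_self])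
      also have "\<dots> = (\<Sum>j\<in>UNIV. \<bar>A $ i $ j\<bar>) * infnorm g"
        by (simp add: sum_distrib_right)
      also have "\<dots> \<le> K * infnorm g"
        using row by (intro mult_right_mono infnorm_pos_le)
      finally show ?thesis using y[of i] by simp
    qed
    then have "infnorm y \<le> K * infnorm g"
      unfolding infnorm_cart[of y] by (intro cSup_least) auto
    then show ?thesis using True by (simp add: p_norm_def)
  next
    case False
    with assms(1) obtain q where q: "p = ereal q" "1 \<le> q" by (cases p) auto
    have "(\<Sum>i\<in>UNIV. \<bar>y $ i\<bar> powr q) \<le> (\<Sum>i\<in>UNIV. (\<Sum>j\<in>UNIV. \<bar>A $ i $ j\<bar> * g $ j) powr q)"
      using y q by (intro sum_mono powr_mono2) auto
    also have "\<dots> \<le> (\<Sum>i\<in>UNIV. K powr (q - 1) * (\<Sum>j\<in>UNIV. \<bar>A $ i $ j\<bar> * g $ j powr q))"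
      using q g row by (intro sum_mono powr_weighted_sum_le) auto
    also have "\<dots> = K powr (q - 1) * (\<Sum>j\<in>UNIV. (\<Sum>i\<in>UNIV. \<bar>A $ i $ j\<bar>) * g $ j powr q)"
      unfolding sum_distrib_left[symmetric] sum_distrib_right by (subst sum.swap) simp
    also have "\<dots> \<le> K powr (q - 1) * (\<Sum>j\<in>UNIV. K * g $ j powr q)"
      using col by (intro mult_left_mono sum_mono mult_right_mono) auto
    also have "\<dots> = K powr q * (\<Sum>j\<in>UNIV. \<bar>g $ j\<bar> powr q)"
      using K g q by (cases "K = 0") (auto simp: powr_diff sum_distrib_left[symmetric])
    finally have "(\<Sum>i\<in>UNIV. \<bar>y $ i\<bar> powr q) powr (1 / q)
                    \<le> (K powr q * (\<Sum>j\<in>UNIV. \<bar>g $ j\<bar> powr q)) powr (1 / q)"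
      using q by (intro powr_mono2 sum_nonneg) auto
    also have "\<dots> = K * (\<Sum>j\<in>UNIV. \<bar>g $ j\<bar> powr q) powr (1 / q)"
      using q K by (simp add: powr_mult powr_powr sum_nonneg)
    finally show ?thesis using q by (simp add: p_norm_def)
  qed
qed

lemma abs_sum_mset_matrix_mult_le:
  fixes A :: "real^'n^'m"
  shows "\<bar>(\<Sum>f\<in>#F. \<bar>A *v f\<bar>) $ i\<bar> \<le> (\<Sum>j\<in>UNIV. \<bar>A $ i $ j\<bar> * (\<Sum>f\<in>#F. \<bar>f\<bar>) $ j)"
proof (induction F)
  case (add f F)
  have "\<bar>(A *v f) $ i\<bar> \<le> (\<Sum>j\<in>UNIV. \<bar>A $ i $ j\<bar> * \<bar>f $ j\<bar>)"
    unfolding matrix_vector_mult_def by (simp add: order_trans[OF sum_abs] abs_mult)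
  then show ?case using add by (simp add: abs_vec_def distrib_left sum.distrib)
qed simp

lemma abs_sum_mset_nonneg: "0 \<le> (\<Sum>f\<in>#F. \<bar>f\<bar>) $ j" for F :: "(real^'n) multiset"
  by (induction F) (auto simp: abs_vec_def)

subsection \<open>Electrical routing\<close>

text \<open>The flow induced by \<open>x\<close> routes the demand of the single edge
  \<open>e0\<close>, so its net value across any vertex set is at most one in absolute
  value.\<close>

lemma electrical_flow_l1_le:
  fixes t h :: "'e::finite \<Rightarrow> 'v::finite"
  assumes "\<Phi> > 0" "mg_expander \<Phi> t h"
    and flow: "incidence t h *v (transpose (incidence t h) *v x) = incidence t h *v axis e0 1"
  shows "(\<Sum>e\<in>UNIV. \<bar>(transpose (incidence t h) *v x) $ e\<bar>) \<le> 2 * (1 + ln (real CARD('e))) / \<Phi>"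
proof -
  have net: "\<bar>\<Sum>e\<in>UNIV. (of_bool (h e \<in> S) - of_bool (t e \<in> S)) * (x $ h e - x $ t e)\<bar> \<le> 1" for S
  proof -
    have "(\<Sum>e\<in>UNIV. (of_bool (h e \<in> S) - of_bool (t e \<in> S)) * (x $ h e - x $ t e))
        = (\<Sum>v\<in>S. (incidence t h *v (transpose (incidence t h) *v x)) $ v)"
      by (simp only: net_flow_across_cut transpose_incidence_mult)
    also have "\<dots> = (\<Sum>e\<in>UNIV. (of_bool (h e \<in> S) - of_bool (t e \<in> S)) * axis e0 1 $ e)"
      unfolding flow by (rule net_flow_across_cut)
    also have "\<dots> = (\<Sum>e\<in>UNIV. if e = e0 then of_bool (h e \<in> S) - of_bool (t e \<in> S) else 0)"
      by (intro sum.cong) (auto simp: axis_def)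
    also have "\<dots> = of_bool (h e0 \<in> S) - of_bool (t e0 \<in> S)" by simp
    finally show ?thesis by simp
  qed
  \<comment> \<open>Across a level cut all flow runs towards the higher potential, so net flow and
    total absolute flow coincide; for lower level sets they differ in sign.\<close>
  have "(\<Sum>e\<in>mg_boundary t h {v. s < x $ v}. \<bar>x $ h e - x $ t e\<bar>) \<le> 1" for s
  proof -
    have "(\<Sum>e\<in>mg_boundary t h {v. s < x $ v}. \<bar>x $ h e - x $ t e\<bar>)
        = (\<Sum>e\<in>UNIV. (of_bool (h e \<in> {v. s < x $ v}) - of_bool (t e \<in> {v. s < x $ v})) * (x $ h e - x $ t e))"
      by (intro sum.mono_neutral_cong_left) (auto simp: mg_boundary_def)
    then show ?thesis using net[of "{v. s < x $ v}"] by linarith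
  qed
  moreover have "(\<Sum>e\<in>mg_boundary t h {v. x $ v < s}. \<bar>x $ h e - x $ t e\<bar>) \<le> 1" for s
  proof -
    have "- (\<Sum>e\<in>mg_boundary t h {v. x $ v < s}. \<bar>x $ h e - x $ t e\<bar>)
        = (\<Sum>e\<in>UNIV. (of_bool (h e \<in> {v. x $ v < s}) - of_bool (t e \<in> {v. x $ v < s})) * (x $ h e - x $ t e))"
      unfolding sum_negf[symmetric]
      by (intro sum.mono_neutral_cong_left) (auto simp: mg_boundary_def)
    then show ?thesis using net[of "{v. x $ v < s}"] by linarith
  qed
  ultimately show ?thesis
    unfolding transpose_incidence_mult by (rule sum_potential_drop_le[OF assms(1,2)])
qed

lemma incidence_electrical_routing:
  assumes "mg_connected t h" "is_demand d"
  shows "incidence t h *v (electrical_routing t h *v d) = d"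
proof -
  have "incidence t h ** electrical_routing t h = mat 1 - avg_matrix"
    using pseudo_inverse_laplacian(1)[OF assms(1)]
    by (simp add: electrical_routing_def laplacian_def matrix_mul_assoc)
  moreover have "avg_matrix *v d = 0"
    using assms(2) by (simp add: is_demand_def vec_eq_iff avg_matrix_mult)
  ultimately show ?thesis
    by (simp add: matrix_vector_mul_assoc matrix_vector_mult_diff_rdistrib)
qed

lemma is_demand_incidence: "is_demand (incidence t h *v f)"
  using net_flow_across_cut[of t h f UNIV] by (simp add: is_demand_def)

text \<open>Column \<open>e0\<close> of \<open>Q\<close> is the electrical flow for the demand of
  \<open>e0\<close>; the row bound follows from the symmetry of \<open>Q\<close>.\<close>

lemma sum_abs_electrical_projection_le:
  fixes t h :: "'e::finite \<Rightarrow> 'v::finite"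
  assumes "mg_connected t h" "\<Phi> > 0" "mg_expander \<Phi> t h"
  defines "Q \<equiv> electrical_routing t h ** incidence t h"
  shows "(\<Sum>e\<in>UNIV. \<bar>Q $ e $ e0\<bar>) \<le> 2 * (1 + ln (real CARD('e))) / \<Phi>"
    and "(\<Sum>e\<in>UNIV. \<bar>Q $ e0 $ e\<bar>) \<le> 2 * (1 + ln (real CARD('e))) / \<Phi>"
proof -
  define x where "x = pseudo_inverse (laplacian t h) *v (incidence t h *v axis e0 1)"
  have "transpose (incidence t h) *v x = electrical_routing t h *v (incidence t h *v axis e0 1)"
    by (simp add: x_def electrical_routing_def matrix_vector_mul_assoc matrix_mul_assoc)
  then have "(\<Sum>e\<in>UNIV. \<bar>(electrical_routing t h *v (incidence t h *v axis e0 1)) $ e\<bar>)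
               \<le> 2 * (1 + ln (real CARD('e))) / \<Phi>"
    using electrical_flow_l1_le[OF assms(2,3), of x e0]
      incidence_electrical_routing[OF assms(1) is_demand_incidence[of t h "axis e0 1"]] by simp
  moreover have "electrical_routing t h *v (incidence t h *v axis e0 1) = column e0 Q"
    by (simp only: Q_def matrix_vector_mult_basis[symmetric] matrix_vector_mul_assoc)
  ultimately show col: "(\<Sum>e\<in>UNIV. \<bar>Q $ e $ e0\<bar>) \<le> 2 * (1 + ln (real CARD('e))) / \<Phi>"
    by (simp add: column_def)
  have "transpose Q = Q"
    using pseudo_inverse_laplacian(2)[OF assms(1)]
    by (simp add: Q_def electrical_routing_def matrix_transpose_mul matrix_mul_assoc)
  then have "Q $ e0 $ e = Q $ e $ e0" for e
    by (metis transpose_def vec_lambda_beta)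
  then show "(\<Sum>e\<in>UNIV. \<bar>Q $ e0 $ e\<bar>) \<le> 2 * (1 + ln (real CARD('e))) / \<Phi>"
    using col by simp
qed

text \<open>If flows \<open>f\<close> route the demands \<open>d\<close>, then \<open>A *v d\<close>
  is \<open>A ** incidence t h\<close> applied to \<open>f\<close>, so the Schur test compares the
  routing with every feasible choice of flows.\<close>

lemma competitive_ratio_le:
  fixes A :: "real^'v^'e" and t h :: "'e::finite \<Rightarrow> 'v::finite"
  assumes routes: "\<And>d. is_demand d \<Longrightarrow> incidence t h *v (A *v d) = d"
    and "1 \<le> p"
    and row: "\<And>i. (\<Sum>j\<in>UNIV. \<bar>(A ** incidence t h) $ i $ j\<bar>) \<le> K"
    and col: "\<And>j. (\<Sum>i\<in>UNIV. \<bar>(A ** incidence t h) $ i $ j\<bar>) \<le> K"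
  shows "competitive_ratio p t h A \<le> ereal K"
  unfolding competitive_ratio_def
proof (rule SUP_least)
  fix D assume "D \<in> {D. (\<forall>d\<in>#D. is_demand d) \<and> 0 < opt_congestion p t h D}"
  then have D: "\<And>d. d \<in># D \<Longrightarrow> is_demand d" and pos: "0 < opt_congestion p t h D" by auto
  let ?N = "p_norm p (\<Sum>d\<in>#D. \<bar>A *v d\<bar>)"
  let ?O = "{p_norm p (\<Sum>f\<in>#F. \<bar>f\<bar>) | F. {#incidence t h *v f. f \<in># F#} = D}"
  have bound: "?N \<le> K * c" if "c \<in> ?O" for c
  proof -
    from that obtain F where c: "c = p_norm p (\<Sum>f\<in>#F. \<bar>f\<bar>)" and F: "{#incidence t h *v f. f \<in># F#} = D"
      by blast
    have "(\<Sum>d\<in>#D. \<bar>A *v d\<bar>) = (\<Sum>f\<in>#F. \<bar>(A ** incidence t h) *v f\<bar>)"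
      unfolding F[symmetric] by (simp add: image_mset.compositionality comp_def matrix_vector_mul_assoc)
    then show ?thesis
      unfolding c using p_norm_schur_test[OF assms(2) row col abs_sum_mset_nonneg abs_sum_mset_matrix_mult_le]
      by simp
  qed
  \<comment> \<open>The routing \<open>A\<close> itself is feasible, so the infimum is over a
    nonempty set.\<close>
  have "{#incidence t h *v f. f \<in># {#A *v d. d \<in># D#}#} = {#d. d \<in># D#}"
    unfolding image_mset.compositionality comp_def
    by (rule image_mset_cong) (simp add: D routes)
  then have ne: "?O \<noteq> {}" by auto
  have "0 \<le> K" by (rule order_trans[OF sum_nonneg row]) simp
  have "?N \<le> K * opt_congestion p t h D"
  \<comment> \<open>For positive \<open>K\<close> the bound passes to the infimum after division by
    \<open>K\<close>; for \<open>K = 0\<close> any feasible choice suffices.\<close>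
  proof (cases "K = 0")
    case True
    then show ?thesis using bound ne by force
  next
    case False
    with \<open>0 \<le> K\<close> have K: "0 < K" by simp
    have "?N / K \<le> Inf ?O"
      using K by (intro cInf_greatest[OF ne]) (use bound in \<open>auto simp: field_simps\<close>)
    then show ?thesis using K by (simp add: opt_congestion_def field_simps)
  qed
  then show "ereal (?N / opt_congestion p t h D) \<le> ereal K"
    using pos by (simp add: field_simps)
qed

theorem theorem1p2:
  fixes t h :: "'e::finite \<Rightarrow> 'v::finite"
    and \<Phi> :: real
    and p :: ereal
  assumes "mg_connected t h"
    and "CARD('e) \<ge> 1"
    and "\<Phi> > 0"
    and "mg_expander \<Phi> t h"
    and "1 \<le> p"
  shows "competitive_ratio p t h (electrical_routing t h)
           \<le> ereal (3 * (ln (2 * real CARD('e)) / \<Phi>))"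
proof -
  have "competitive_ratio p t h (electrical_routing t h) \<le> ereal (2 * (1 + ln (real CARD('e))) / \<Phi>)"
    using assms by (intro competitive_ratio_le incidence_electrical_routing sum_abs_electrical_projection_le)
  also have "2 * (1 + ln (real CARD('e))) \<le> 3 * ln (2 * real CARD('e))"
  proof -
    define L where "L = ln (real CARD('e))"
    have "0 \<le> L" unfolding L_def using assms(2) by (intro ln_ge_zero) linarith
    then have "2 * (1 + L) \<le> 3 * (ln 2 + L)" using ln2_ge_two_thirds by argo
    also have "ln 2 + L = ln (2 * real CARD('e))"
      unfolding L_def using assms(2) by (intro ln_mult_pos[symmetric]) auto
    finally show ?thesis by (simp only: L_def)
  qed
  then have "ereal (2 * (1 + ln (real CARD('e))) / \<Phi>) \<le> ereal (3 * (ln (2 * real CARD('e)) / \<Phi>))"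
    using assms(3) by (simp add: divide_right_mono)
  finally show ?thesis .
qed

end
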